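(* (Correctness of Brzozowski's algorithm.) Let $\mathcal{A}$ be a non-deterministic automaton over an alphabet $A$, accepting a language $L\subseteq A^*$. Then the deterministic automaton $$\mathtt{determinize}(\mathtt{transpose}(\mathtt{determinize}(\mathtt{transpose}(\mathcal{A}))))$$ is (up to isomorphism) the minimal deterministic automaton for $L$.
   Context: A non-deterministic automaton over $A$ consists of a set $Q$ of states (not necessarily finite), a set of initial states $I\subseteq Q$, a set of final states $F\subseteq Q$ and a transition relation $\delta_a\subseteq Q\times Q$ for each $a\in A$; it accepts the set of words labelling some path from an initial to a final state. A deterministic automaton is one with a single initial state and with each $\delta_a$ a (total) function $Q\to Q$; it is regarded as a non-deterministic automaton in the obvious way. $\mathtt{transpose}$ takes a non-deterministic automaton, reverses all its transitions and swaps the initial and final states (so it accepts the mirrored language). $\mathtt{determinize}$ takes a non-deterministic automaton, applies the powerset construction (states: subsets of $Q$; initial state: $I$; $a$-transition: $S\mapsto\{q'\mid\exists q\in S,\ (q,q')\in\delta_a\}$; final states: the subsets meeting $F$) and restricts to the states reachable from the initial state. The minimal deterministic automaton for $L$ is the deterministic automaton accepting $L$ which is a quotient of a sub-automaton of every deterministic automaton accepting $L$; concretely, its states are the quotient languages $w^{-1}L=\{u\in A^*\mid wu\in L\}$ for $w\in A^*$, with initial state $L$, transitions $K\mapsto a^{-1}K$, and final states those containing $\varepsilon$. *)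

theory Defs
  imports Main
begin

text \<open>
  The alphabet is an explicit, arbitrary set \<open>A\<close> of letters and the state set an arbitrary set, both
  possibly infinite or empty. Values of \<open>trans\<close> at letters outside \<open>A\<close> are irrelevant to all the
  notions below.
\<close>

record ('q, 'a) automaton =
  states :: "'q set"
  initial :: "'q set"
  final :: "'q set"
  trans :: "'a \<Rightarrow> ('q \<times> 'q) set"

definition nfa :: "'a set \<Rightarrow> ('q, 'a) automaton \<Rightarrow> bool" where
  "nfa A M \<longleftrightarrow> initial M \<subseteq> states M \<and> final M \<subseteq> states M \<and>
     (\<forall>a\<in>A. trans M a \<subseteq> states M \<times> states M)"

definition dfa :: "'a set \<Rightarrow> ('q, 'a) automaton \<Rightarrow> bool" where
  "dfa A M \<longleftrightarrow> nfa A M \<and> (\<exists>q. initial M = {q}) \<and>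
     (\<forall>a\<in>A. \<forall>q\<in>states M. \<exists>!q'. (q, q') \<in> trans M a)"

inductive path :: "('q, 'a) automaton \<Rightarrow> 'q \<Rightarrow> 'a list \<Rightarrow> 'q \<Rightarrow> bool" for M where
  path_Nil: "q \<in> states M \<Longrightarrow> path M q [] q"
| path_Cons: "(p, q) \<in> trans M a \<Longrightarrow> path M q w r \<Longrightarrow> path M p (a # w) r"

definition lang :: "'a set \<Rightarrow> ('q, 'a) automaton \<Rightarrow> 'a list set" where
  "lang A M = {w \<in> lists A. \<exists>p\<in>initial M. \<exists>q\<in>final M. path M p w q}"

definition transpose_aut :: "('q, 'a) automaton \<Rightarrow> ('q, 'a) automaton" where
  "transpose_aut M = \<lparr>states = states M, initial = final M, final = initial M,
     trans = (\<lambda>a. (trans M a)\<inverse>)\<rparr>"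

definition powerset_aut :: "('q, 'a) automaton \<Rightarrow> ('q set, 'a) automaton" where
  "powerset_aut M = \<lparr>states = Pow (states M), initial = {initial M},
     final = {S \<in> Pow (states M). S \<inter> final M \<noteq> {}},
     trans = (\<lambda>a. {(S, {q'. \<exists>q\<in>S. (q, q') \<in> trans M a}) | S. S \<in> Pow (states M)})\<rparr>"

definition reachable :: "'a set \<Rightarrow> ('q, 'a) automaton \<Rightarrow> 'q set" where
  "reachable A M = {q. \<exists>p\<in>initial M. \<exists>w\<in>lists A. path M p w q}"

definition restrict_aut :: "('q, 'a) automaton \<Rightarrow> 'q set \<Rightarrow> ('q, 'a) automaton" where
  "restrict_aut M R = \<lparr>states = states M \<inter> R, initial = initial M \<inter> R, final = final M \<inter> R,
     trans = (\<lambda>a. trans M a \<inter> R \<times> R)\<rparr>"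

definition determinize :: "'a set \<Rightarrow> ('q, 'a) automaton \<Rightarrow> ('q set, 'a) automaton" where
  "determinize A M = restrict_aut (powerset_aut M) (reachable A (powerset_aut M))"

definition aut_iso :: "'a set \<Rightarrow> ('p, 'a) automaton \<Rightarrow> ('q, 'a) automaton \<Rightarrow> bool" where
  "aut_iso A M N \<longleftrightarrow> (\<exists>h. bij_betw h (states M) (states N) \<and>
     h ` initial M = initial N \<and> h ` final M = final N \<and>
     (\<forall>a\<in>A. \<forall>p\<in>states M. \<forall>q\<in>states M. (p, q) \<in> trans M a \<longleftrightarrow> (h p, h q) \<in> trans N a))"

text \<open>
  Sub-automata and quotients of deterministic automata. A sub-automaton is again required to be
  deterministic, i.e. it is a set of states containing the initial state and closed under
  transitions. A quotient is the image of a surjective morphism which preserves and reflects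
  finality.
\<close>

definition subautomaton :: "'a set \<Rightarrow> ('q, 'a) automaton \<Rightarrow> ('q, 'a) automaton \<Rightarrow> bool" where
  "subautomaton A N M \<longleftrightarrow> dfa A N \<and> states N \<subseteq> states M \<and> initial N = initial M \<and>
     final N = final M \<inter> states N \<and>
     (\<forall>a\<in>A. trans N a = trans M a \<inter> states N \<times> states N)"

definition quotient_aut :: "'a set \<Rightarrow> ('p, 'a) automaton \<Rightarrow> ('q, 'a) automaton \<Rightarrow> bool" where
  "quotient_aut A K N \<longleftrightarrow> (\<exists>h. h ` states N = states K \<and> h ` initial N = initial K \<and>
     (\<forall>q\<in>states N. h q \<in> final K \<longleftrightarrow> q \<in> final N) \<and>
     (\<forall>a\<in>A. \<forall>p q. (p, q) \<in> trans N a \<longrightarrow> (h p, h q) \<in> trans K a))"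

definition left_quotient :: "'a set \<Rightarrow> 'a list \<Rightarrow> 'a list set \<Rightarrow> 'a list set" where
  "left_quotient A w L = {u \<in> lists A. w @ u \<in> L}"

definition minimal_dfa :: "'a set \<Rightarrow> 'a list set \<Rightarrow> ('a list set, 'a) automaton" where
  "minimal_dfa A L = \<lparr>states = {left_quotient A w L | w. w \<in> lists A}, initial = {L},
     final = {left_quotient A w L | w. w \<in> lists A \<and> [] \<in> left_quotient A w L},
     trans = (\<lambda>a. {(left_quotient A w L, left_quotient A [a] (left_quotient A w L)) | w.
       w \<in> lists A})\<rparr>"

end

theory Submission
  imports Defs
begin

text \<open>
  A deterministic automaton with all states reachable is minimal as soon as distinct states accept
  distinct languages. The latter holds for the determinization of the transpose of any
  deterministic automaton \<open>D\<close> with all states reachable: if \<open>q\<close> is reached in \<open>D\<close> by \<open>v\<close>, then a set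
  \<open>S\<close> of states of \<open>D\<close> contains \<open>q\<close> iff the state \<open>S\<close> accepts \<open>rev v\<close>, so \<open>S\<close> is determined by the
  language it accepts.
\<close>

section \<open>Languages of states, paths and determinism\<close>

definition state_lang :: "'a set \<Rightarrow> ('q, 'a) automaton \<Rightarrow> 'q \<Rightarrow> 'a list set" where
  "state_lang A M p = {w \<in> lists A. \<exists>q\<in>final M. path M p w q}"

lemma lang_eq_state_lang: "lang A M = (\<Union>p\<in>initial M. state_lang A M p)"
  by (auto simp: lang_def state_lang_def)

inductive_simps path_Nil_iff: "path M p [] q"
inductive_simps path_Cons_iff: "path M p (a # w) q"

lemma path_in_states:
  assumes "nfa A M" "path M p w q" "w \<in> lists A"
  shows "p \<in> states M" "q \<in> states M"
  using assms(2,3,1) by (induction) (auto simp: nfa_def)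

text \<open>An empty path exists only at a state. For empty \<open>u\<close> the endpoint
  \<open>p\<close> is a state because \<open>v\<close> is a word over \<open>A\<close>;
  \<open>nfa\<close> does not constrain \<open>trans\<close> at other letters.\<close>

lemma path_append_iff:
  assumes "nfa A M" "u \<in> lists A" "v \<in> lists A"
  shows "path M p (u @ v) r \<longleftrightarrow> (\<exists>q. path M p u q \<and> path M q v r)"
  using assms(2)
proof (induction u arbitrary: p rule: list.induct)
  case Nil
  then show ?case
    using assms by (auto simp: path_Nil_iff dest: path_in_states)
qed (auto simp: path_Cons_iff)

lemma path_singleton_iff:
  assumes "nfa A M" "a \<in> A"
  shows "path M p [a] q \<longleftrightarrow> (p, q) \<in> trans M a"
  using assms by (auto simp: path_Cons_iff path_Nil_iff nfa_def)

lemma dfa_nfa: "dfa A M \<Longrightarrow> nfa A M"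
  by (simp add: dfa_def)

lemma dfa_initialE:
  assumes "dfa A M"
  obtains i where "initial M = {i}" "i \<in> states M"
  using assms unfolding dfa_def nfa_def by fastforce

lemma dfa_path_unique:
  assumes "dfa A M" "w \<in> lists A" "path M p w q" "path M p w q'"
  shows "q = q'"
  using assms(2-4)
proof (induction w arbitrary: p rule: list.induct)
  case Nil
  then show ?case by (simp add: path_Nil_iff)
next
  case (Cons a w)
  then obtain r r' where r: "(p, r) \<in> trans M a" "path M r w q"
    and r': "(p, r') \<in> trans M a" "path M r' w q'"
    by (auto simp: path_Cons_iff)
  have "p \<in> states M" "a \<in> A"
    using Cons.prems path_in_states[OF dfa_nfa[OF assms(1)]] by auto
  then have "r = r'"
    using assms(1) r(1) r'(1) unfolding dfa_def by blast
  with r r' Cons show ?case by auto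
qed

lemma dfa_path_exists:
  assumes "dfa A M" "w \<in> lists A" "p \<in> states M"
  shows "\<exists>q. path M p w q"
  using assms(2,3)
proof (induction w arbitrary: p rule: list.induct)
  case Nil
  then show ?case by (simp add: path_Nil_iff)
next
  case (Cons a w)
  then have "p \<in> states M" "a \<in> A"
    by auto
  then obtain r where r: "(p, r) \<in> trans M a"
    using assms(1) unfolding dfa_def by blast
  then have "r \<in> states M"
    using assms(1) Cons.prems by (auto simp: dfa_def nfa_def)
  then obtain q where "path M r w q"
    using Cons by auto
  with r show ?case by (auto simp: path_Cons_iff)
qed

text \<open>By determinism \<open>q\<close> is the only state that \<open>w\<close> leads to from
  \<open>p\<close>, so every path from \<open>p\<close> labelled \<open>w @ u\<close> passes through
  \<open>q\<close>. This links reading words to taking left quotients.\<close>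

lemma state_lang_path:
  assumes "dfa A M" "w \<in> lists A" "path M p w q"
  shows "state_lang A M q = left_quotient A w (state_lang A M p)"
proof -
  have "path M p (w @ u) f \<longleftrightarrow> path M q u f" if "u \<in> lists A" for u f
    using path_append_iff[OF dfa_nfa[OF assms(1)] assms(2) that] assms(3)
      dfa_path_unique[OF assms] by blast
  then show ?thesis
    using assms(2) by (auto simp: state_lang_def left_quotient_def)
qed

lemma Nil_in_state_lang_iff:
  assumes "nfa A M"
  shows "[] \<in> state_lang A M p \<longleftrightarrow> p \<in> final M"
  using assms by (auto simp: state_lang_def path_Nil_iff nfa_def)

section \<open>Transposition\<close>

lemma transpose_aut_sel [simp]:
  "initial (transpose_aut M) = final M" "final (transpose_aut M) = initial M"
  by (simp_all add: transpose_aut_def)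

lemma path_transpose_iff:
  assumes "nfa A M" "w \<in> lists A"
  shows "path (transpose_aut M) p w q \<longleftrightarrow> path M q (rev w) p"
  using assms(2)
proof (induction w arbitrary: p rule: list.induct)
  case Nil
  then show ?case by (auto simp: path_Nil_iff transpose_aut_def)
next
  case (Cons a w)
  \<comment> \<open>The first letter read in the transpose is the last letter of the original path,
    so \<open>[a]\<close> is split off at the end of \<open>rev w @ [a]\<close>.\<close>
  then show ?case
    using path_append_iff[OF assms(1), of "rev w" "[a]"] path_singleton_iff[OF assms(1)]
    by (auto simp: path_Cons_iff transpose_aut_def in_lists_conv_set)
qed

lemma nfa_transpose: "nfa A M \<Longrightarrow> nfa A (transpose_aut M)"
  by (auto simp: nfa_def transpose_aut_def)

lemma lang_transpose:
  assumes "nfa A M"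
  shows "lang A (transpose_aut M) = {w \<in> lists A. rev w \<in> lang A M}"
proof -
  have "(\<exists>p\<in>initial (transpose_aut M). \<exists>q\<in>final (transpose_aut M). path (transpose_aut M) p w q) \<longleftrightarrow>
      (\<exists>p\<in>initial M. \<exists>q\<in>final M. path M p (rev w) q)" if "w \<in> lists A" for w
    unfolding path_transpose_iff[OF assms that] transpose_aut_sel by blast
  moreover have "rev w \<in> lists A \<longleftrightarrow> w \<in> lists A" for w
    by (simp add: in_lists_conv_set)
  ultimately show ?thesis
    unfolding lang_def by blast
qed

section \<open>Powerset construction\<close>

lemma dfa_powerset:
  assumes "nfa A M"
  shows "dfa A (powerset_aut M)"
  using assms unfolding dfa_def nfa_def powerset_aut_def by auto

text \<open>Each letter replaces the current set by the set of its successors, which is the only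
  choice; hence the induction has to generalise over the starting set.\<close>

lemma path_powerset_iff:
  assumes "nfa A M" "w \<in> lists A" "S \<subseteq> states M"
  shows "path (powerset_aut M) S w T \<longleftrightarrow> T = {q'. \<exists>q\<in>S. path M q w q'}"
  using assms(2,3)
proof (induction w arbitrary: S rule: list.induct)
  case Nil
  then show ?case by (auto simp: path_Nil_iff powerset_aut_def)
next
  case (Cons a w)
  let ?S' = "{q'. \<exists>q\<in>S. (q, q') \<in> trans M a}"
  have "?S' \<subseteq> states M"
    using assms(1) Cons.prems by (auto simp: nfa_def)
  moreover have "path (powerset_aut M) S (a # w) T \<longleftrightarrow> path (powerset_aut M) ?S' w T"
    using Cons.prems by (auto simp: path_Cons_iff powerset_aut_def)
  ultimately show ?case
    using Cons.IH[of ?S'] Cons.prems by (auto simp: path_Cons_iff)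
qed

lemma state_lang_powerset:
  assumes "nfa A M" "S \<subseteq> states M"
  shows "state_lang A (powerset_aut M) S = (\<Union>q\<in>S. state_lang A M q)"
proof -
  \<comment> \<open>Final states of the powerset automaton have to be subsets of
    \<open>states M\<close>, so meeting \<open>final M\<close> alone does not make a set
    final.\<close>
  have "{q'. \<exists>q\<in>S. path M q w q'} \<subseteq> states M" if "w \<in> lists A" for w
    using path_in_states[OF assms(1)] that by blast
  then have "(\<exists>T\<in>final (powerset_aut M). path (powerset_aut M) S w T) \<longleftrightarrow>
      (\<exists>q\<in>S. \<exists>r\<in>final M. path M q w r)" if "w \<in> lists A" for w
    using path_powerset_iff[OF assms(1) that assms(2)] that by (auto simp: powerset_aut_def)
  then show ?thesis
    unfolding state_lang_def by blast
qed

section \<open>Restriction to reachable states\<close>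

text \<open>The reachable states are closed under transitions by letters of \<open>A\<close>, so a
  path that starts among them never leaves them.\<close>

lemma path_restrict_reachable_iff:
  assumes "nfa A M" "w \<in> lists A" "p \<in> reachable A M"
  shows "path (restrict_aut M (reachable A M)) p w q \<longleftrightarrow> path M p w q"
  using assms(2,3)
proof (induction w arbitrary: p rule: list.induct)
  case Nil
  then show ?case by (auto simp: path_Nil_iff restrict_aut_def)
next
  case (Cons a w)
  \<comment> \<open>Closure under one letter: a word leading to \<open>p\<close> is extended by
    \<open>a\<close>.\<close>
  have "r \<in> reachable A M" if "(p, r) \<in> trans M a" for r
  proof -
    obtain i v where "i \<in> initial M" "v \<in> lists A" "path M i v p"
      using Cons.prems by (auto simp: reachable_def)
    moreover have "path M p [a] r"
      using that path_singleton_iff[OF assms(1)] Cons.prems by auto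
    ultimately have "path M i (v @ [a]) r" "v @ [a] \<in> lists A"
      using path_append_iff[OF assms(1), of v "[a]"] Cons.prems by auto
    then show ?thesis
      using \<open>i \<in> initial M\<close> unfolding reachable_def by blast
  qed
  then show ?case
    using Cons by (auto simp: path_Cons_iff restrict_aut_def)
qed

lemma initial_subset_reachable:
  assumes "nfa A M"
  shows "initial M \<subseteq> reachable A M"
  using assms by (force simp: reachable_def nfa_def intro: path_Nil)

lemma reachable_subset_states:
  assumes "nfa A M"
  shows "reachable A M \<subseteq> states M"
  using path_in_states[OF assms] unfolding reachable_def by blast

text \<open>Paths from initial states run through reachable states only, so the paths that witness
  reachability survive the restriction.\<close>

lemma reachable_restrict_reachable:
  assumes "nfa A M"
  shows "reachable A (restrict_aut M (reachable A M)) = states (restrict_aut M (reachable A M))"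
    (is "reachable A ?N = _")
proof -
  have ini: "initial ?N = initial M"
    using initial_subset_reachable[OF assms] by (auto simp: restrict_aut_def)
  have "path ?N p w q \<longleftrightarrow> path M p w q" if "p \<in> initial M" "w \<in> lists A" for p w q
    using that path_restrict_reachable_iff[OF assms] initial_subset_reachable[OF assms] by blast
  then have "reachable A ?N = {q. \<exists>p\<in>initial M. \<exists>w\<in>lists A. path M p w q}"
    unfolding reachable_def[of A ?N] ini by blast
  also have "\<dots> = reachable A M"
    by (simp add: reachable_def)
  finally show ?thesis
    using reachable_subset_states[OF assms] by (auto simp: restrict_aut_def)
qed

lemma state_lang_restrict_reachable:
  assumes "nfa A M" "p \<in> reachable A M"
  shows "state_lang A (restrict_aut M (reachable A M)) p = state_lang A M p"
proof -
  let ?N = "restrict_aut M (reachable A M)"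
  \<comment> \<open>Targets of paths in the restriction are reachable, and on reachable states the
    two automata agree about finality.\<close>
  have "q \<in> reachable A M" if "w \<in> lists A" "path ?N p w q" for w q
  proof -
    have "nfa A ?N"
      using assms(1) by (auto simp: nfa_def restrict_aut_def)
    from path_in_states(2)[OF this that(2,1)] show ?thesis
      by (simp add: restrict_aut_def)
  qed
  then have "q \<in> final ?N \<longleftrightarrow> q \<in> final M" if "w \<in> lists A" "path ?N p w q" for w q
    using that by (auto simp: restrict_aut_def)
  then show ?thesis
    using path_restrict_reachable_iff[OF assms(1) _ assms(2)]
    unfolding state_lang_def by blast
qed

lemma lang_restrict_reachable:
  assumes "nfa A M"
  shows "lang A (restrict_aut M (reachable A M)) = lang A M"
proof -
  have "initial (restrict_aut M (reachable A M)) = initial M"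
    using initial_subset_reachable[OF assms] by (auto simp: restrict_aut_def)
  then show ?thesis
    using state_lang_restrict_reachable[OF assms] initial_subset_reachable[OF assms]
    unfolding lang_eq_state_lang by blast
qed

lemma dfa_restrict_reachable:
  assumes "dfa A M"
  shows "dfa A (restrict_aut M (reachable A M))" (is "dfa A ?N")
  unfolding dfa_def
proof (intro conjI ballI)
  note nfa = dfa_nfa[OF assms]
  show nfa': "nfa A ?N"
    using nfa by (auto simp: nfa_def restrict_aut_def)
  show "\<exists>q. initial ?N = {q}"
    using assms initial_subset_reachable[OF nfa] by (auto simp: dfa_def restrict_aut_def)
  fix a q assume a: "a \<in> A" and q: "q \<in> states ?N"
  then have q': "q \<in> reachable A M" "q \<in> states M"
    by (auto simp: restrict_aut_def)
  \<comment> \<open>A reachable state loses no successor, by the path lemma for the one-letter word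
    \<open>[a]\<close>; this keeps the transition function total.\<close>
  have "(q, r) \<in> trans ?N a \<longleftrightarrow> (q, r) \<in> trans M a" for r
    using path_restrict_reachable_iff[OF nfa _ q'(1), of "[a]"] a
      path_singleton_iff[OF nfa] path_singleton_iff[OF nfa'] by auto
  then show "\<exists>!r. (q, r) \<in> trans ?N a"
    using assms a q' by (auto simp: dfa_def)
qed

text \<open>Provides the sub-automaton of an arbitrary deterministic automaton of which the minimal
  one will be a quotient.\<close>

lemma subautomaton_restrict_reachable:
  assumes "dfa A M"
  shows "subautomaton A (restrict_aut M (reachable A M)) M"
  using dfa_restrict_reachable[OF assms] dfa_nfa[OF assms]
    initial_subset_reachable[OF dfa_nfa[OF assms]]
  by (auto simp: subautomaton_def restrict_aut_def nfa_def)

section \<open>Determinization\<close>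

lemma dfa_determinize: "nfa A M \<Longrightarrow> dfa A (determinize A M)"
  by (simp add: determinize_def dfa_restrict_reachable dfa_powerset)

lemma reachable_determinize:
  "nfa A M \<Longrightarrow> reachable A (determinize A M) = states (determinize A M)"
  by (simp add: determinize_def reachable_restrict_reachable dfa_nfa dfa_powerset)

lemma state_lang_determinize:
  assumes "nfa A M" "S \<in> states (determinize A M)"
  shows "state_lang A (determinize A M) S = (\<Union>q\<in>S. state_lang A M q)"
  using assms state_lang_restrict_reachable[OF dfa_nfa[OF dfa_powerset[OF assms(1)]]]
    state_lang_powerset[OF assms(1)]
  by (auto simp: determinize_def restrict_aut_def powerset_aut_def)

lemma lang_determinize:
  assumes "nfa A M"
  shows "lang A (determinize A M) = lang A M"
proof -
  have "lang A (determinize A M) = lang A (powerset_aut M)"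
    by (simp add: determinize_def lang_restrict_reachable dfa_nfa dfa_powerset assms)
  also have "\<dots> = lang A M"
    using state_lang_powerset[OF assms, of "initial M"] assms
    by (simp add: lang_eq_state_lang powerset_aut_def nfa_def)
  finally show ?thesis .
qed

section \<open>Separation of states by their languages\<close>

lemma inj_on_state_lang_determinize_transpose:
  assumes "dfa A D" and reach: "reachable A D = states D"
  shows "inj_on (state_lang A (determinize A (transpose_aut D)))
    (states (determinize A (transpose_aut D)))"
proof -
  let ?N = "transpose_aut D"
  note nfa = dfa_nfa[OF assms(1)]
  obtain i where i: "initial D = {i}" "i \<in> states D"
    using assms(1) by (rule dfa_initialE)
  \<comment> \<open>In the transpose \<open>i\<close> is the only final state, so an accepting path
    from \<open>q\<close> is a path of \<open>D\<close> from \<open>i\<close> to \<open>q\<close>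
    read backwards.\<close>
  have state_lang_N: "u \<in> state_lang A ?N q \<longleftrightarrow> u \<in> lists A \<and> path D i (rev u) q" for u q
    using path_transpose_iff[OF nfa] i by (auto simp: state_lang_def transpose_aut_def)
  \<comment> \<open>\<open>S\<close> is recovered from its language alone: every \<open>q\<close> in
    \<open>S\<close> is reached by some \<open>v\<close>, and \<open>rev v\<close> tests whether
    \<open>q\<close> belongs to \<open>S\<close>.\<close>
  have S_eq: "S = {q. \<exists>v\<in>lists A. path D i v q \<and> rev v \<in> state_lang A (determinize A ?N) S}"
    if S: "S \<in> states (determinize A ?N)" for S
  proof -
    have sl: "state_lang A (determinize A ?N) S = (\<Union>q\<in>S. state_lang A ?N q)"
      by (rule state_lang_determinize[OF nfa_transpose[OF nfa] S])
    have "S \<subseteq> reachable A D"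
      using S reach by (auto simp: determinize_def restrict_aut_def powerset_aut_def
          transpose_aut_def)
    then have "\<exists>v\<in>lists A. path D i v q" if "q \<in> S" for q
      using that i by (auto simp: reachable_def)
    moreover have "rev v \<in> state_lang A (determinize A ?N) S \<longleftrightarrow> q \<in> S"
      if "v \<in> lists A" "path D i v q" for v q
    proof -
      have "rev v \<in> state_lang A (determinize A ?N) S \<longleftrightarrow> (\<exists>q'\<in>S. path D i v q')"
        using that(1) by (simp add: sl state_lang_N in_lists_conv_set)
      \<comment> \<open>Determinism of \<open>D\<close> forces the state \<open>q'\<close> reached
        by \<open>v\<close> to be \<open>q\<close> itself.\<close>
      then show ?thesis
        using dfa_path_unique[OF assms(1) that] that(2) by blast
    qed
    ultimately show ?thesis by blast
  qed
  show ?thesis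
  proof (rule inj_onI)
    fix S T
    assume "S \<in> states (determinize A ?N)" "T \<in> states (determinize A ?N)"
      and "state_lang A (determinize A ?N) S = state_lang A (determinize A ?N) T"
    then show "S = T"
      using S_eq[of S] S_eq[of T] by simp
  qed
qed

section \<open>Comparison with left quotients and minimality\<close>

text \<open>A state to which \<open>w\<close> leads from the initial state has the left quotient by
  \<open>w\<close> as its language. Reachability yields a word for every state, totality a state for
  every word.\<close>

lemma state_lang_image_states:
  assumes "dfa A B" and reach: "reachable A B = states B"
  shows "state_lang A B ` states B = {left_quotient A w (lang A B) | w. w \<in> lists A}"
proof -
  obtain i where i: "initial B = {i}" "i \<in> states B"
    using assms(1) by (rule dfa_initialE)
  have L: "state_lang A B i = lang A B"
    by (simp add: lang_eq_state_lang i)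
  show ?thesis
  proof (intro subset_antisym subsetI)
    fix K assume "K \<in> state_lang A B ` states B"
    then obtain p where "p \<in> reachable A B" "K = state_lang A B p"
      using reach by auto
    then obtain w where "w \<in> lists A" "path B i w p" "K = state_lang A B p"
      using i by (auto simp: reachable_def)
    then show "K \<in> {left_quotient A w (lang A B) | w. w \<in> lists A}"
      using state_lang_path[OF assms(1), of w i p] L by auto
  next
    fix K assume "K \<in> {left_quotient A w (lang A B) | w. w \<in> lists A}"
    then obtain w where w: "w \<in> lists A" "K = left_quotient A w (lang A B)"
      by auto
    obtain q where q: "path B i w q"
      using dfa_path_exists[OF assms(1) w(1) i(2)] by auto
    then show "K \<in> state_lang A B ` states B"
      using state_lang_path[OF assms(1) w(1) q] w(2) L
        path_in_states(2)[OF dfa_nfa[OF assms(1)] q w(1)] by (auto simp: image_iff)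
  qed
qed

text \<open>The \<open>a\<close>-successor of \<open>p\<close> has the left quotient as its
  language, and by injectivity no other state has it. Transitions can thus be read off from
  languages.\<close>

lemma trans_iff_state_lang:
  assumes "dfa A B" and inj: "inj_on (state_lang A B) (states B)"
    and a: "a \<in> A" and p: "p \<in> states B" and q: "q \<in> states B"
  shows "(p, q) \<in> trans B a \<longleftrightarrow> state_lang A B q = left_quotient A [a] (state_lang A B p)"
proof -
  note nfa = dfa_nfa[OF assms(1)]
  have step: "state_lang A B r = left_quotient A [a] (state_lang A B p)"
    if "(p, r) \<in> trans B a" for r
    using state_lang_path[OF assms(1), of "[a]" p r] that a path_singleton_iff[OF nfa a] by auto
  obtain r where r: "(p, r) \<in> trans B a"
    using assms(1) a p unfolding dfa_def by blast
  then have "r \<in> states B"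
    using nfa a by (auto simp: nfa_def)
  then show ?thesis
    using step r q inj by (metis inj_onD)
qed

text \<open>The languages of the states of \<open>B\<close> and of \<open>N\<close> are the same
  left quotients of the common language. Sending a state of \<open>N\<close> to the unique state of
  \<open>B\<close> with the same language is therefore well defined and onto.\<close>

lemma quotient_autI:
  assumes "dfa A B" "reachable A B = states B" and inj: "inj_on (state_lang A B) (states B)"
    and "dfa A N" "reachable A N = states N" and L: "lang A N = lang A B"
  shows "quotient_aut A B N"
proof -
  define h where "h = the_inv_into (states B) (state_lang A B) \<circ> state_lang A N"
  have im: "state_lang A N ` states N = state_lang A B ` states B"
    using state_lang_image_states[OF assms(1,2)] state_lang_image_states[OF assms(4,5)] L by simp
  have h: "h q \<in> states B" "state_lang A B (h q) = state_lang A N q" if "q \<in> states N" for q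
  proof -
    have "state_lang A N q \<in> state_lang A B ` states B"
      using that im by blast
    then show "h q \<in> states B" "state_lang A B (h q) = state_lang A N q"
      using the_inv_into_into[OF inj] f_the_inv_into_f[OF inj] by (auto simp: h_def)
  qed
  have h_eq: "h q = p" if "q \<in> states N" "p \<in> states B" "state_lang A N q = state_lang A B p"
    for p q
    using inj_onD[OF inj, of "h q" p] h that by auto
  obtain i where i: "initial B = {i}" "i \<in> states B"
    using assms(1) by (rule dfa_initialE)
  obtain j where j: "initial N = {j}" "j \<in> states N"
    using assms(4) by (rule dfa_initialE)
  show ?thesis
    unfolding quotient_aut_def
  proof (intro exI conjI ballI allI impI)
    show "h ` states N = states B"
    proof (intro subset_antisym subsetI)
      fix p assume p: "p \<in> states B"
      then have "state_lang A B p \<in> state_lang A N ` states N"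
        using im by blast
      then show "p \<in> h ` states N"
        using h_eq p by force
    qed (use h in auto)
    show "h ` initial N = initial B"
      using h_eq[of j i] i j L by (simp add: lang_eq_state_lang)
  next
    fix q assume "q \<in> states N"
    \<comment> \<open>A state is final iff its language contains the empty word, and
      \<open>h\<close> preserves the language.\<close>
    then show "h q \<in> final B \<longleftrightarrow> q \<in> final N"
      using h[of q] Nil_in_state_lang_iff[OF dfa_nfa] assms(1,4) by metis
  next
    fix a p q assume a: "a \<in> A" and pq: "(p, q) \<in> trans N a"
    note nfa = dfa_nfa[OF assms(4)]
    have pq': "p \<in> states N" "q \<in> states N"
      using nfa a pq by (auto simp: nfa_def)
    have "state_lang A N q = left_quotient A [a] (state_lang A N p)"
      using state_lang_path[OF assms(4), of "[a]" p q] pq a path_singleton_iff[OF nfa a] by auto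
    then show "(h p, h q) \<in> trans B a"
      using trans_iff_state_lang[OF assms(1) inj a] h pq' by simp
  qed
qed

text \<open>The isomorphism is \<open>state_lang A B\<close> itself: it is injective by assumption,
  and its image on the states is the set of left quotients.\<close>

lemma aut_iso_minimal_dfaI:
  assumes "dfa A B" "reachable A B = states B" and inj: "inj_on (state_lang A B) (states B)"
  shows "aut_iso A B (minimal_dfa A (lang A B))"
proof -
  note nfa = dfa_nfa[OF assms(1)]
  note im = state_lang_image_states[OF assms(1,2)]
  obtain i where i: "initial B = {i}" "i \<in> states B"
    using assms(1) by (rule dfa_initialE)
  show ?thesis
    unfolding aut_iso_def
  proof (intro exI conjI ballI)
    show "bij_betw (state_lang A B) (states B) (states (minimal_dfa A (lang A B)))"
      using inj im by (simp add: bij_betw_def minimal_dfa_def)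
    show "state_lang A B ` initial B = initial (minimal_dfa A (lang A B))"
      using i by (simp add: lang_eq_state_lang minimal_dfa_def)
    have "final B = {p \<in> states B. [] \<in> state_lang A B p}"
      using Nil_in_state_lang_iff[OF nfa] nfa by (auto simp: nfa_def)
    then have "state_lang A B ` final B = {K \<in> state_lang A B ` states B. [] \<in> K}"
      by auto
    then show "state_lang A B ` final B = final (minimal_dfa A (lang A B))"
      unfolding im by (auto simp: minimal_dfa_def)
  next
    fix a p q assume a: "a \<in> A" and p: "p \<in> states B" and q: "q \<in> states B"
    have "state_lang A B p \<in> {left_quotient A w (lang A B) | w. w \<in> lists A}"
      using p im by blast
    \<comment> \<open>\<open>minimal_dfa\<close> describes a transition through a representative
      \<open>w\<close>, but its target depends only on the source language, so the choice of
      \<open>w\<close> does not matter.\<close>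
    then have "(state_lang A B p, K) \<in> trans (minimal_dfa A (lang A B)) a \<longleftrightarrow>
        K = left_quotient A [a] (state_lang A B p)" for K
      by (auto simp: minimal_dfa_def)
    then show "(p, q) \<in> trans B a \<longleftrightarrow>
        (state_lang A B p, state_lang A B q) \<in> trans (minimal_dfa A (lang A B)) a"
      using trans_iff_state_lang[OF assms(1) inj a p q] by simp
  qed
qed

theorem mainTheorem5:
  fixes A :: "'a set" and M :: "('q, 'a) automaton" and L :: "'a list set"
    and B :: "('q set set, 'a) automaton"
  assumes "nfa A M" and "lang A M = L"
  defines "B \<equiv> determinize A (transpose_aut (determinize A (transpose_aut M)))"
  shows "dfa A B \<and> lang A B = L \<and>
    (\<forall>D :: ('d, 'a) automaton. dfa A D \<and> lang A D = L \<longrightarrow>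
       (\<exists>N. subautomaton A N D \<and> quotient_aut A B N)) \<and>
    aut_iso A B (minimal_dfa A L)"
proof -
  \<comment> \<open>The inner determinization turns an arbitrary \<open>M\<close> into a
    deterministic automaton with all states reachable, as the separation lemma requires of
    \<open>D\<close>.\<close>
  define C where "C = determinize A (transpose_aut M)"
  have B: "B = determinize A (transpose_aut C)"
    by (simp add: B_def C_def)
  note nfaT = nfa_transpose[OF assms(1)]
  have C: "dfa A C" "reachable A C = states C"
    unfolding C_def by (intro dfa_determinize reachable_determinize nfaT)+
  note nfaTC = nfa_transpose[OF dfa_nfa[OF C(1)]]
  have dfaB: "dfa A B" and reachB: "reachable A B = states B"
    unfolding B by (intro dfa_determinize reachable_determinize nfaTC)+
  have injB: "inj_on (state_lang A B) (states B)"
    unfolding B by (rule inj_on_state_lang_determinize_transpose[OF C])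
  have "lang A B = {w \<in> lists A. rev w \<in> lang A C}"
    unfolding B by (simp add: lang_determinize[OF nfaTC] lang_transpose[OF dfa_nfa[OF C(1)]])
  also have "lang A C = {w \<in> lists A. rev w \<in> lang A M}"
    unfolding C_def by (simp add: lang_determinize[OF nfaT] lang_transpose[OF assms(1)])
  \<comment> \<open>The two mirrorings cancel, since \<open>rev\<close> is an involution that maps
    words over \<open>A\<close> to words over \<open>A\<close>.\<close>
  finally have langB: "lang A B = L"
    using assms(2) by (auto simp: lang_def in_lists_conv_set)
  \<comment> \<open>The sub-automaton is the reachable part of \<open>D\<close>, which still accepts
    \<open>L\<close>.\<close>
  have "\<exists>N. subautomaton A N D \<and> quotient_aut A B N" if D: "dfa A D" "lang A D = L"
    for D :: "('d, 'a) automaton"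
  proof (intro exI conjI)
    note nfaD = dfa_nfa[OF D(1)]
    show "subautomaton A (restrict_aut D (reachable A D)) D"
      by (rule subautomaton_restrict_reachable[OF D(1)])
    show "quotient_aut A B (restrict_aut D (reachable A D))"
      by (rule quotient_autI[OF dfaB reachB injB dfa_restrict_reachable[OF D(1)]
            reachable_restrict_reachable[OF nfaD]])
        (simp add: lang_restrict_reachable[OF nfaD] D(2) langB)
  qed
  then show ?thesis
    using dfaB langB aut_iso_minimal_dfaI[OF dfaB reachB injB] by auto
qed

end
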